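(* The Markov policy $\pi^*=(\widetilde g_0,\widetilde g_1,\ldots)$ with $\widetilde g_n(\cdot)=f^*(\cdot,\gamma\beta^n)$ (which is optimal for the exponential utility dividend problem) is a band-policy.
   Context: Setting. $X=\mathbb{Z}$, $\beta\in(0,1)$ is a discount factor, $Z_1,Z_2,\ldots$ are i.i.d. integer-valued random variables with $\mathbb{P}(Z_n=k)=q_k$, $k\in\mathbb{Z}$; $Z$ denotes a generic copy. Standing assumptions: $\mathbb{E}Z^+<\infty$ (where $Z^+=\max\{Z,0\}$) and $\mathbb{P}(Z<0)>0$. Action sets: $A(x)=\{0,\ldots,x\}$ for $x\ge0$ and $A(x)=\{0\}$ for $x<0$; $D=\{(x,a):x\in X,a\in A(x)\}$. A policy $\pi=(\pi_k)_{k\ge0}$ is a sequence of maps assigning to each history $(x_0,a_0,\ldots,x_{k-1},a_{k-1},x_k)$ with $(x_m,a_m)\in D$ an action in $A(x_k)$; $\Pi$ is the set of all policies. Let $\Gamma$ be the set of functions $g$ on $X$ with $g(x)\in A(x)$ for all $x$; a Markov policy is $\pi=(g_k)_{k\ge0}$ with $g_k\in\Gamma$ and $a_k=g_k(x_k)$. Under $\pi$ and $x_0=x$, $a_k=\pi_k(x_0,a_0,\ldots,x_k)$, and $x_{k+1}=x_k-a_k+Z_{k+1}$ if $x_k\ge0$, $x_{k+1}=x_k$ if $x_k<0$; expectation is $\mathbb{E}_x^\pi$. Fix $\gamma<0$ and let $I=[\gamma,0)$. For $(x,\theta)\in X\times I$, $J(x,\theta)=\inf_{\pi\in\Pi}\mathbb{E}_x^\pi\exp\{\theta\sum_{k=0}^\infty\beta^k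 a_k\}$. The exponential utility dividend problem is to maximise $\mathbb{E}_x^\pi[\frac1\gamma\exp\{\gamma\sum_{k=0}^\infty\beta^ka_k\}]$ over $\pi\in\Pi$. For $x\ge0$, $\theta\in I$ let $G(x,\theta)=\sum_{k=-x}^\infty J(x+k,\theta)q_k+\sum_{k=-\infty}^{-x-1}q_k$. For $x\ge0$, $f^*(x,\theta)$ is the largest minimiser over $a\in A(x)$ of $a\mapsto e^{\theta a}G(x-a,\theta\beta)$; for $x<0$, $f^*(x,\theta)=0$. Band-functions. $g\in\Gamma$ is a band-function if there exist $n\in\mathbb{N}_0$ and $c_0,\ldots,c_n,d_1,\ldots,d_n\in\mathbb{N}_0$ with $d_k-c_{k-1}\ge2$ for $k=1,\ldots,n$ and $0\le c_0\le d_1\le c_1\le d_2\le\cdots\le d_n\le c_n$ such that $g(x)=0$ if $x\le c_0$; $g(x)=x-c_k$ if $c_k<x<d_{k+1}$ ($0\le k\le n-1$); $g(x)=0$ if $d_k\le x\le c_k$ ($1\le k\le n$); $g(x)=x-c_n$ if $x>c_n$. A Markov policy $(g_m)_{m\in\mathbb{N}_0}$ is a band-policy if $g_m$ is a band-function for every $m\in\mathbb{N}_0$. *)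

theory Defs
  imports "HOL-Probability.Probability"
begin

definition actions :: "int \<Rightarrow> int set" where
  "actions x = (if x \<ge> 0 then {0..x} else {0})"

definition state_actions :: "(int \<times> int) set" where
  "state_actions = {(x, a). a \<in> actions x}"

text \<open>
  The decision at stage \<open>k\<close> is \<open>\<pi> k h x\<close>, where \<open>h = [(x\<^sub>0, a\<^sub>0), \<dots>, (x\<^bsub>k-1\<^esub>, a\<^bsub>k-1\<^esub>)]\<close> lists
  the past in chronological order and \<open>x\<close> is the current state. Values of \<open>\<pi>\<close> at arguments that
  are not histories of length \<open>k\<close> over \<open>state_actions\<close> are unconstrained and never used.
\<close>

type_synonym policy = "nat \<Rightarrow> (int \<times> int) list \<Rightarrow> int \<Rightarrow> int"

definition policies :: "policy set" where
  "policies = {\<pi>. \<forall>k h x. length h = k \<and> set h \<subseteq> state_actions \<longrightarrow> \<pi> k h x \<in> actions x}"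

definition decision_rules :: "(int \<Rightarrow> int) set" where
  "decision_rules = {g. \<forall>x. g x \<in> actions x}"

definition markov_policy :: "(nat \<Rightarrow> int \<Rightarrow> int) \<Rightarrow> policy" where
  "markov_policy g = (\<lambda>k h x. g k x)"

definition next_state :: "int \<Rightarrow> int \<Rightarrow> int \<Rightarrow> int" where
  "next_state x a z = (if x \<ge> 0 then x - a + z else x)"

text \<open>
  The past and the current state at time \<open>k\<close> along a realisation \<open>z\<close> of the increments, whose
  entries \<open>z 1, z 2, \<dots>\<close> are the ones used.
\<close>

primrec run :: "policy \<Rightarrow> int \<Rightarrow> (nat \<Rightarrow> int) \<Rightarrow> nat \<Rightarrow> (int \<times> int) list \<times> int" where
  "run \<pi> x z 0 = ([], x)"
| "run \<pi> x z (Suc k) =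
     (let (h, y) = run \<pi> x z k; a = \<pi> k h y
      in (h @ [(y, a)], next_state y a (z (Suc k))))"

definition payout :: "policy \<Rightarrow> int \<Rightarrow> (nat \<Rightarrow> int) \<Rightarrow> nat \<Rightarrow> int" where
  "payout \<pi> x z k = (let (h, y) = run \<pi> x z k in \<pi> k h y)"

text \<open>The discounted sum is formed in \<open>[0, \<infinity>]\<close>, since it can diverge on a null set.\<close>

definition total_payout :: "real \<Rightarrow> policy \<Rightarrow> int \<Rightarrow> (nat \<Rightarrow> int) \<Rightarrow> ennreal" where
  "total_payout \<beta> \<pi> x z = (\<Sum>k. ennreal (\<beta> ^ k * real_of_int (payout \<pi> x z k)))"

text \<open>For \<open>\<theta> < 0\<close>: the map \<open>s \<mapsto> exp (\<theta> s)\<close> on \<open>[0, \<infinity>]\<close>, with \<open>exp (-\<infinity>) = 0\<close>.\<close>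

definition exp_disutility :: "real \<Rightarrow> ennreal \<Rightarrow> real" where
  "exp_disutility \<theta> s = (if s = \<infinity> then 0 else exp (\<theta> * enn2real s))"

definition J :: "'w measure \<Rightarrow> (nat \<Rightarrow> 'w \<Rightarrow> int) \<Rightarrow> real \<Rightarrow> int \<Rightarrow> real \<Rightarrow> real" where
  "J M Z \<beta> x \<theta> =
     (INF \<pi>\<in>policies. \<integral>\<omega>. exp_disutility \<theta> (total_payout \<beta> \<pi> x (\<lambda>n. Z n \<omega>)) \<partial>M)"

definition G ::
    "'w measure \<Rightarrow> (nat \<Rightarrow> 'w \<Rightarrow> int) \<Rightarrow> (int \<Rightarrow> real) \<Rightarrow> real \<Rightarrow> int \<Rightarrow> real \<Rightarrow> real" where
  "G M Z q \<beta> x \<theta> =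
     (\<Sum>\<^sub>\<infinity>k\<in>{- x..}. J M Z \<beta> (x + k) \<theta> * q k) + (\<Sum>\<^sub>\<infinity>k\<in>{..- x - 1}. q k)"

definition fstar ::
    "'w measure \<Rightarrow> (nat \<Rightarrow> 'w \<Rightarrow> int) \<Rightarrow> (int \<Rightarrow> real) \<Rightarrow> real \<Rightarrow> int \<Rightarrow> real \<Rightarrow> int" where
  "fstar M Z q \<beta> x \<theta> =
     (if x \<ge> 0
      then Max {a. is_arg_min (\<lambda>a. exp (\<theta> * real_of_int a) * G M Z q \<beta> (x - a) (\<theta> * \<beta>))
                     (\<lambda>a. a \<in> actions x) a}
      else 0)"

definition expected_utility ::
    "'w measure \<Rightarrow> (nat \<Rightarrow> 'w \<Rightarrow> int) \<Rightarrow> real \<Rightarrow> real \<Rightarrow> int \<Rightarrow> policy \<Rightarrow> real" where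
  "expected_utility M Z \<beta> \<gamma> x \<pi> =
     (\<integral>\<omega>. 1 / \<gamma> * exp_disutility \<gamma> (total_payout \<beta> \<pi> x (\<lambda>n. Z n \<omega>)) \<partial>M)"

definition optimal_policy ::
    "'w measure \<Rightarrow> (nat \<Rightarrow> 'w \<Rightarrow> int) \<Rightarrow> real \<Rightarrow> real \<Rightarrow> policy \<Rightarrow> bool" where
  "optimal_policy M Z \<beta> \<gamma> \<pi> \<longleftrightarrow>
     (\<forall>x. is_arg_max (expected_utility M Z \<beta> \<gamma> x) (\<lambda>\<pi>'. \<pi>' \<in> policies) \<pi>)"

text \<open>Only \<open>c 0, \<dots>, c n\<close> and \<open>d 1, \<dots>, d n\<close> matter.\<close>

definition band_function :: "(int \<Rightarrow> int) \<Rightarrow> bool" where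
  "band_function g \<longleftrightarrow> g \<in> decision_rules \<and>
     (\<exists>(n::nat) (c::nat \<Rightarrow> nat) (d::nat \<Rightarrow> nat).
        (\<forall>k\<in>{1..n}. int (d k) - int (c (k - 1)) \<ge> 2) \<and>
        (\<forall>k\<in>{1..n}. c (k - 1) \<le> d k \<and> d k \<le> c k) \<and>
        (\<forall>x. x \<le> int (c 0) \<longrightarrow> g x = 0) \<and>
        (\<forall>k<n. \<forall>x. int (c k) < x \<and> x < int (d (k + 1)) \<longrightarrow> g x = x - int (c k)) \<and>
        (\<forall>k\<in>{1..n}. \<forall>x. int (d k) \<le> x \<and> x \<le> int (c k) \<longrightarrow> g x = 0) \<and>
        (\<forall>x. x > int (c n) \<longrightarrow> g x = x - int (c n)))"

definition band_policy :: "policy \<Rightarrow> bool" where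
  "band_policy \<pi> \<longleftrightarrow> (\<exists>g. \<pi> = markov_policy g \<and> (\<forall>m. band_function (g m)))"

end

theory Submission
  imports Defs
begin

text \<open>
  Write \<open>\<theta>\<close> for the current risk parameter, which one period of discounting turns into \<open>\<theta> * \<beta>\<close>.
  After paying out \<open>a\<close> in a state \<open>x \<ge> 0\<close> the level \<open>y = x - a\<close> is retained, and the cost of this
  decision is \<open>exp (\<theta> * a) * G y (\<theta> * \<beta>) = exp (\<theta> * x) * h y\<close> with
  \<open>h y = exp (- \<theta> * y) * G y (\<theta> * \<beta>)\<close>. The factor \<open>exp (\<theta> * x)\<close> does not depend on the
  decision, so in every state the same function \<open>h\<close> is minimised, over \<open>{0..x}\<close>. The largest
  minimising payout retains the smallest minimiser, which is the last level up to \<open>x\<close> at which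
  \<open>h\<close> attains a strict record minimum. The map that sends a state to its distance from the last
  point of a finite set containing 0 is a band-function: the bands in which nothing is paid are the
  maximal blocks of consecutive points (\<open>band_breakpoints_exist\<close>).

  It remains to see that there are only finitely many records. The state can only be raised by the
  positive parts of the increments, so by Jensen's inequality the value function is at least
  \<open>exp (\<theta> * (max x 0 + slack))\<close>, where \<open>slack\<close> is the expected discounted sum of these gains.
  Hence \<open>h y \<ge> exp (- \<theta> * (1 - \<beta>) * y + \<theta> * slack)\<close>, which tends to infinity because
  \<open>\<theta> < 0\<close>, whereas \<open>h\<close> is at most \<open>h 0 \<le> 1\<close> at a record (\<open>finite_record_levels\<close>).

  For the optimality, iterating the dynamic programming operator from the constant 1 gives a
  decreasing sequence whose limit \<open>w\<close> solves the optimality equation and satisfies the same lower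
  bound. Under any policy, the expected value of
  \<open>exp (\<theta> * payments so far) * w (current state) (\<theta> * \<beta> ^ N)\<close> starts at \<open>w x \<theta>\<close> and is
  nondecreasing in the number \<open>N\<close> of stages, and it is constant if every decision minimises the
  right-hand side of the optimality equation (\<open>continuation_value_Suc\<close>). Since \<open>w \<le> 1\<close>, this
  gives \<open>w x \<theta>\<close> as a lower bound for the disutility of every policy. For a minimising policy the
  bound is attained: by the lower bound on \<open>w\<close> the factor \<open>w\<close> differs from 1 in mean by at most
  \<open>\<bar>\<theta>\<bar> * \<beta> ^ N\<close> times a quantity that grows linearly in \<open>N\<close> (\<open>remaining_value_gap\<close>).
  Therefore \<open>J = w\<close>, and the decisions \<open>fstar\<close> are minimising in this sense.
\<close>

section \<open>The optimality equation\<close>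

locale dividend_recursion =
  fixes p :: "int pmf" and \<beta> :: real
  assumes beta_pos: "0 < \<beta>" and beta_less_1: "\<beta> < 1"
    and integrable_pos_part: "integrable (measure_pmf p) (\<lambda>z. real_of_int (max z 0))"
begin

definition mean_pos :: real where
  "mean_pos = measure_pmf.expectation p (\<lambda>z. real_of_int (max z 0))"

text \<open>
  The expected discounted sum of the gains in all later periods, \<open>(\<Sum>k. \<beta> ^ (k + 1) * mean_pos)\<close>.
\<close>

definition slack :: real where
  "slack = \<beta> * mean_pos / (1 - \<beta>)"

text \<open>
  The right-hand side of the optimality equation at the decision \<open>a\<close>, for a state \<open>x \<ge> 0\<close>, when the
  problem from the next period on has value \<open>u\<close>.
\<close>

definition stage_cost :: "(int \<Rightarrow> real \<Rightarrow> real) \<Rightarrow> int \<Rightarrow> real \<Rightarrow> int \<Rightarrow> real" where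
  "stage_cost u x \<theta> a =
     exp (\<theta> * real_of_int a) * measure_pmf.expectation p (\<lambda>z. u (x - a + z) (\<theta> * \<beta>))"

text \<open>
  Minimal disutility when payments stop after \<open>N\<close> periods.
\<close>

primrec horizon_value :: "nat \<Rightarrow> int \<Rightarrow> real \<Rightarrow> real" where
  "horizon_value 0 = (\<lambda>x \<theta>. 1)"
| "horizon_value (Suc N) =
     (\<lambda>x \<theta>. if x < 0 then 1 else Min (stage_cost (horizon_value N) x \<theta> ` {0..x}))"

definition limit_value :: "int \<Rightarrow> real \<Rightarrow> real" where
  "limit_value x \<theta> = (INF N. horizon_value N x \<theta>)"

lemma mean_pos_nonneg: "0 \<le> mean_pos"
  unfolding mean_pos_def by (rule integral_nonneg_AE) auto

lemma slack_nonneg: "0 \<le> slack"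
  unfolding slack_def using mean_pos_nonneg beta_pos beta_less_1 by simp

text \<open>
  Consistency of the slack over one period; it makes the lower bound on the value functions
  reproduce itself under the dynamic programming operator.
\<close>

lemma slack_eq: "slack = \<beta> * (mean_pos + slack)"
  unfolding slack_def using beta_less_1 by (simp add: field_simps)

lemma integrable_unit_interval:
  fixes u :: "int \<Rightarrow> real"
  assumes "\<And>z. 0 \<le> u z" "\<And>z. u z \<le> 1"
  shows "integrable (measure_pmf p) u"
  by (rule measure_pmf.integrable_const_bound[where B = 1]) (use assms in auto)

lemma expectation_unit_interval:
  fixes u :: "int \<Rightarrow> real"
  assumes "\<And>z. 0 \<le> u z" "\<And>z. u z \<le> 1"
  shows "0 \<le> measure_pmf.expectation p u" "measure_pmf.expectation p u \<le> 1"
proof -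
  show "0 \<le> measure_pmf.expectation p u"
    by (rule integral_nonneg_AE) (use assms in auto)
  have "measure_pmf.expectation p u \<le> measure_pmf.expectation p (\<lambda>_. 1)"
    by (intro integral_mono integrable_unit_interval assms) auto
  then show "measure_pmf.expectation p u \<le> 1" by simp
qed

text \<open>
  Jensen's inequality for the exponential, by integrating its tangent at the mean
  \<open>s * (b + mean_pos)\<close>.
\<close>

lemma expectation_ge_exp:
  fixes u :: "int \<Rightarrow> real"
  assumes lower: "\<And>z. exp (s * (b + real_of_int (max z 0))) \<le> u z" and upper: "\<And>z. u z \<le> 1"
  shows "exp (s * (b + mean_pos)) \<le> measure_pmf.expectation p u"
proof -
  let ?c = "exp (s * (b + mean_pos))"
  let ?lin = "\<lambda>z. ?c * (1 + s * (real_of_int (max z 0) - mean_pos))"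
  have "?lin z \<le> u z" for z
  proof -
    have "?lin z \<le> ?c * exp (s * (real_of_int (max z 0) - mean_pos))"
      by (intro mult_left_mono exp_ge_add_one_self) auto
    also have "\<dots> = exp (s * (b + real_of_int (max z 0)))"
      by (simp add: exp_add[symmetric] algebra_simps)
    finally show ?thesis using lower[of z] by linarith
  qed
  moreover have nonneg: "0 \<le> u z" for z
    using lower[of z] exp_ge_zero[of "s * (b + real_of_int (max z 0))"] by linarith
  moreover have int_lin: "integrable (measure_pmf p) ?lin"
    using integrable_pos_part by simp
  ultimately have "measure_pmf.expectation p ?lin \<le> measure_pmf.expectation p u"
    by (intro integral_mono int_lin integrable_unit_interval nonneg upper) auto
  moreover have "measure_pmf.expectation p ?lin = ?c"
    using integrable_pos_part by (simp add: mean_pos_def[symmetric])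
  ultimately show ?thesis by simp
qed

lemma next_discount_nonpos: "\<theta> \<le> 0 \<Longrightarrow> \<theta> * \<beta> \<le> 0"
  using beta_pos by (simp add: mult_nonpos_nonneg)

lemma expectation_after_step_ge_exp:
  fixes u :: "int \<Rightarrow> real"
  assumes "s \<le> 0" and "0 \<le> y"
    and lower: "\<And>x. exp (s * (real_of_int (max x 0) + slack)) \<le> u x" and upper: "\<And>x. u x \<le> 1"
  shows "exp (s * ((real_of_int y + slack) + mean_pos)) \<le> measure_pmf.expectation p (\<lambda>z. u (y + z))"
proof (rule expectation_ge_exp[OF _ upper])
  fix z
  have "real_of_int (max (y + z) 0) \<le> real_of_int y + real_of_int (max z 0)"
    using \<open>0 \<le> y\<close> by linarith
  then have "s * ((real_of_int y + slack) + real_of_int (max z 0))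
      \<le> s * (real_of_int (max (y + z) 0) + slack)"
    by (intro mult_left_mono_neg \<open>s \<le> 0\<close>) linarith
  then show "exp (s * ((real_of_int y + slack) + real_of_int (max z 0))) \<le> u (y + z)"
    using lower[of "y + z"] by (meson exp_le_cancel_iff order_trans)
qed

text \<open>
  The induction step for the bounds on the value functions. One unit paid now contributes a full
  unit to the exponent and one unit retained at most \<open>\<beta>\<close>, so the lower bound does not depend on \<open>a\<close>.
\<close>

lemma stage_cost_bounds:
  assumes "\<theta> \<le> 0" and "0 \<le> a" and "a \<le> x"
    and lower: "\<And>y. exp (\<theta> * \<beta> * (real_of_int (max y 0) + slack)) \<le> u y (\<theta> * \<beta>)"
    and upper: "\<And>y. u y (\<theta> * \<beta>) \<le> 1"
  shows "exp (\<theta> * (real_of_int x + slack)) \<le> stage_cost u x \<theta> a" and "stage_cost u x \<theta> a \<le> 1"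
proof -
  let ?E = "measure_pmf.expectation p (\<lambda>z. u (x - a + z) (\<theta> * \<beta>))"
  have nonneg: "0 \<le> u y (\<theta> * \<beta>)" for y
    using lower[of y] by (meson exp_ge_zero order_trans)
  have "exp (\<theta> * \<beta> * ((real_of_int (x - a) + slack) + mean_pos)) \<le> ?E"
    by (rule expectation_after_step_ge_exp[where u = "\<lambda>y. u y (\<theta> * \<beta>)", OF _ _ lower upper])
       (use assms next_discount_nonpos in auto)
  then have "exp (\<theta> * a) * exp (\<theta> * \<beta> * ((real_of_int (x - a) + slack) + mean_pos))
      \<le> stage_cost u x \<theta> a"
    unfolding stage_cost_def by (intro mult_left_mono) auto
  moreover have "exp (\<theta> * (real_of_int x + slack))
      \<le> exp (\<theta> * a) * exp (\<theta> * \<beta> * ((real_of_int (x - a) + slack) + mean_pos))"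
  proof -
    have "\<beta> * real_of_int (x - a) \<le> real_of_int (x - a)"
      using \<open>a \<le> x\<close> beta_less_1 mult_right_mono[of \<beta> 1 "real_of_int (x - a)"] by simp
    then have "real_of_int a + \<beta> * ((real_of_int (x - a) + slack) + mean_pos) \<le> real_of_int x + slack"
      using slack_eq by (simp add: algebra_simps)
    then have "\<theta> * (real_of_int x + slack)
        \<le> \<theta> * (real_of_int a + \<beta> * ((real_of_int (x - a) + slack) + mean_pos))"
      using \<open>\<theta> \<le> 0\<close> by (rule mult_left_mono_neg)
    then show ?thesis by (simp add: exp_add[symmetric] algebra_simps)
  qed
  ultimately show "exp (\<theta> * (real_of_int x + slack)) \<le> stage_cost u x \<theta> a" by linarith
  have "exp (\<theta> * a) \<le> 1" using assms by (simp add: mult_nonpos_nonneg)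
  moreover have "0 \<le> ?E" "?E \<le> 1" using nonneg upper expectation_unit_interval by auto
  ultimately show "stage_cost u x \<theta> a \<le> 1"
    unfolding stage_cost_def by (simp add: mult_le_one)
qed

lemma horizon_value_bounds:
  assumes "\<theta> \<le> 0"
  shows "exp (\<theta> * (real_of_int (max x 0) + slack)) \<le> horizon_value N x \<theta>"
    and "horizon_value N x \<theta> \<le> 1"
  using assms
proof (induction N arbitrary: x \<theta>)
  case 0
  {
    case 1 then show ?case using slack_nonneg by (simp add: mult_nonpos_nonneg)
  next
    case 2 then show ?case by simp
  }
next
  case (Suc N)
  note IH = Suc.IH[OF next_discount_nonpos]
  {
    case 1
    show ?case
    proof (cases "x < 0")
      case True then show ?thesis using 1 slack_nonneg by (simp add: mult_nonpos_nonneg)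
    next
      case False
      then have "exp (\<theta> * (real_of_int x + slack)) \<le> stage_cost (horizon_value N) x \<theta> a"
        if "a \<in> {0..x}" for a using that 1 by (intro stage_cost_bounds IH) auto
      with False show ?thesis by (auto simp: max_def)
    qed
  next
    case 2
    show ?case
    proof (cases "x < 0")
      case True then show ?thesis by simp
    next
      case False
      then have "stage_cost (horizon_value N) x \<theta> 0 \<le> 1"
        using 2 by (intro stage_cost_bounds IH) auto
      moreover have "Min (stage_cost (horizon_value N) x \<theta> ` {0..x})
          \<le> stage_cost (horizon_value N) x \<theta> 0"
        using False by (intro Min_le) auto
      ultimately have "Min (stage_cost (horizon_value N) x \<theta> ` {0..x}) \<le> 1"
        by (rule order_trans[rotated])
      then show ?thesis using False by simp
    qed
  }
qed

lemma horizon_value_nonneg: "\<theta> \<le> 0 \<Longrightarrow> 0 \<le> horizon_value N x \<theta>"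
  using horizon_value_bounds(1) by (meson exp_ge_zero order_trans)

lemma stage_cost_mono:
  assumes "\<And>y. 0 \<le> u y (\<theta> * \<beta>)" "\<And>y. u y (\<theta> * \<beta>) \<le> u' y (\<theta> * \<beta>)" "\<And>y. u' y (\<theta> * \<beta>) \<le> 1"
  shows "stage_cost u x \<theta> a \<le> stage_cost u' x \<theta> a"
  unfolding stage_cost_def
  by (intro mult_left_mono integral_mono integrable_unit_interval) (use assms in \<open>auto intro: order_trans[OF assms(2,3)] order_trans[OF assms(1,2)]\<close>)

lemma horizon_value_Suc_le: "\<theta> \<le> 0 \<Longrightarrow> horizon_value (Suc N) x \<theta> \<le> horizon_value N x \<theta>"
proof (induction N arbitrary: x \<theta>)
  case 0
  then show ?case using horizon_value_bounds(2)[of \<theta> "Suc 0" x] by simp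
next
  case (Suc N)
  show ?case
  proof (cases "x < 0")
    case False
    have le: "stage_cost (horizon_value (Suc N)) x \<theta> a \<le> stage_cost (horizon_value N) x \<theta> a" for a
      by (intro stage_cost_mono horizon_value_nonneg horizon_value_bounds Suc.IH
          next_discount_nonpos Suc.prems)
    have "Min (stage_cost (horizon_value N) x \<theta> ` {0..x}) \<in> stage_cost (horizon_value N) x \<theta> ` {0..x}"
      using False by (intro Min_in) auto
    then obtain a where "a \<in> {0..x}"
      "Min (stage_cost (horizon_value N) x \<theta> ` {0..x}) = stage_cost (horizon_value N) x \<theta> a" by auto
    moreover have "Min (stage_cost (horizon_value (Suc N)) x \<theta> ` {0..x})
        \<le> stage_cost (horizon_value (Suc N)) x \<theta> a"
      using \<open>a \<in> {0..x}\<close> by (intro Min_le) auto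
    ultimately have "Min (stage_cost (horizon_value (Suc N)) x \<theta> ` {0..x})
        \<le> Min (stage_cost (horizon_value N) x \<theta> ` {0..x})"
      using le[of a] by linarith
    then show ?thesis using False by (simp del: horizon_value.simps add: horizon_value.simps(2))
  qed simp
qed

lemma horizon_value_tendsto:
  assumes "\<theta> \<le> 0"
  shows "(\<lambda>N. horizon_value N x \<theta>) \<longlonglongrightarrow> limit_value x \<theta>"
  unfolding limit_value_def
  by (rule LIMSEQ_decseq_INF)
     (use assms horizon_value_nonneg horizon_value_Suc_le in \<open>auto intro!: bdd_belowI2 decseq_SucI\<close>)

lemma limit_value_bounds:
  assumes "\<theta> \<le> 0"
  shows "exp (\<theta> * (real_of_int (max x 0) + slack)) \<le> limit_value x \<theta>"
    and "limit_value x \<theta> \<le> 1"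
proof -
  note lim = horizon_value_tendsto[OF assms]
  show "exp (\<theta> * (real_of_int (max x 0) + slack)) \<le> limit_value x \<theta>"
    by (intro LIMSEQ_le_const[OF lim] exI[of _ 0] allI impI horizon_value_bounds(1) assms)
  show "limit_value x \<theta> \<le> 1"
    by (intro LIMSEQ_le_const2[OF lim] exI[of _ 0] allI impI horizon_value_bounds(2) assms)
qed

lemma limit_value_nonneg: "\<theta> \<le> 0 \<Longrightarrow> 0 \<le> limit_value x \<theta>"
  using limit_value_bounds(1) by (meson exp_ge_zero order_trans)

lemma limit_value_le_horizon_value:
  assumes "\<theta> \<le> 0" shows "limit_value x \<theta> \<le> horizon_value N x \<theta>"
  by (rule decseq_ge[OF _ horizon_value_tendsto[OF assms]])
     (intro decseq_SucI horizon_value_Suc_le assms)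

lemma limit_value_ruined: "x < 0 \<Longrightarrow> limit_value x \<theta> = 1"
proof -
  assume "x < 0"
  then have "horizon_value N x \<theta> = 1" for N by (cases N) auto
  then show ?thesis by (simp add: limit_value_def)
qed

text \<open>
  Dominated convergence carries the inequality over from the finite horizons.
\<close>

lemma limit_value_le_stage_cost:
  assumes "\<theta> \<le> 0" "0 \<le> a" "a \<le> x"
  shows "limit_value x \<theta> \<le> stage_cost limit_value x \<theta> a"
proof -
  have nonpos: "\<theta> * \<beta> \<le> 0" using assms next_discount_nonpos by simp
  have "(\<lambda>N. measure_pmf.expectation p (\<lambda>z. horizon_value N (x - a + z) (\<theta> * \<beta>)))
      \<longlonglongrightarrow> measure_pmf.expectation p (\<lambda>z. limit_value (x - a + z) (\<theta> * \<beta>))"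
    by (rule integral_dominated_convergence[where w = "\<lambda>_. 1"])
       (simp_all add: horizon_value_tendsto[OF nonpos] horizon_value_bounds(2)[OF nonpos]
          horizon_value_nonneg[OF nonpos])
  then have lim: "(\<lambda>N. stage_cost (horizon_value N) x \<theta> a) \<longlonglongrightarrow> stage_cost limit_value x \<theta> a"
    unfolding stage_cost_def by (intro tendsto_mult_left)
  have "limit_value x \<theta> \<le> stage_cost (horizon_value N) x \<theta> a" for N
  proof -
    have "Min (stage_cost (horizon_value N) x \<theta> ` {0..x}) \<le> stage_cost (horizon_value N) x \<theta> a"
      using assms by (intro Min_le) auto
    then show ?thesis
      using limit_value_le_horizon_value[of \<theta> x "Suc N"] assms by simp
  qed
  then show ?thesis by (intro LIMSEQ_le_const[OF lim] exI[of _ 0] allI impI)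
qed

text \<open>
  The optimality equation. Passing to the limit inside the minimum is avoided: the finite-horizon
  values decrease to the limit value, so each of them is already at least the minimal limiting cost.
\<close>

lemma limit_value_eq_minimal_stage_cost:
  assumes "\<theta> \<le> 0" "0 \<le> a" "a \<le> x"
    and min: "\<And>b. 0 \<le> b \<Longrightarrow> b \<le> x \<Longrightarrow> stage_cost limit_value x \<theta> a \<le> stage_cost limit_value x \<theta> b"
  shows "limit_value x \<theta> = stage_cost limit_value x \<theta> a"
proof (rule antisym)
  show "limit_value x \<theta> \<le> stage_cost limit_value x \<theta> a"
    using assms by (intro limit_value_le_stage_cost)
  have "stage_cost limit_value x \<theta> a \<le> horizon_value (Suc N) x \<theta>" for N
  proof -
    have "stage_cost limit_value x \<theta> a \<le> stage_cost (horizon_value N) x \<theta> b" if "b \<in> {0..x}" for b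
    proof -
      have "stage_cost limit_value x \<theta> b \<le> stage_cost (horizon_value N) x \<theta> b"
        using assms by (intro stage_cost_mono limit_value_nonneg limit_value_le_horizon_value
            horizon_value_bounds next_discount_nonpos)
      with min[of b] that show ?thesis by auto
    qed
    then show ?thesis using assms by auto
  qed
  then show "stage_cost limit_value x \<theta> a \<le> limit_value x \<theta>"
    by (intro LIMSEQ_le_const[OF LIMSEQ_Suc[OF horizon_value_tendsto[OF \<open>\<theta> \<le> 0\<close>]]]
        exI[of _ 0] allI impI)
qed

end

section \<open>Paths of the controlled reserve\<close>

lemma run_Suc:
  "run \<pi> x z (Suc k) =
     (fst (run \<pi> x z k) @ [(snd (run \<pi> x z k), payout \<pi> x z k)],
      next_state (snd (run \<pi> x z k)) (payout \<pi> x z k) (z (Suc k)))"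
  by (simp add: payout_def split_beta Let_def)

lemma payout_eq: "payout \<pi> x z k = \<pi> k (fst (run \<pi> x z k)) (snd (run \<pi> x z k))"
  by (simp add: payout_def split_beta)

lemma length_run: "length (fst (run \<pi> x z k)) = k"
  by (induction k) (simp_all add: run_Suc del: run.simps(2))

lemma run_admissible:
  assumes "\<pi> \<in> policies"
  shows "set (fst (run \<pi> x z k)) \<subseteq> state_actions"
    and "payout \<pi> x z k \<in> actions (snd (run \<pi> x z k))"
proof -
  have feasible: "payout \<pi> x z k \<in> actions (snd (run \<pi> x z k))"
    if "set (fst (run \<pi> x z k)) \<subseteq> state_actions" for k
  proof -
    have "\<forall>h y. length h = k \<and> set h \<subseteq> state_actions \<longrightarrow> \<pi> k h y \<in> actions y"
      using assms by (auto simp: policies_def)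
    then show ?thesis using that by (simp add: payout_eq length_run)
  qed
  show "set (fst (run \<pi> x z k)) \<subseteq> state_actions"
  proof (induction k)
    case (Suc k)
    then show ?case using feasible[OF Suc] by (simp add: run_Suc state_actions_def del: run.simps(2))
  qed simp
  then show "payout \<pi> x z k \<in> actions (snd (run \<pi> x z k))" by (rule feasible)
qed

lemma payout_nonneg: "\<pi> \<in> policies \<Longrightarrow> 0 \<le> payout \<pi> x z k"
  using run_admissible(2)[of \<pi> x z k] by (auto simp: actions_def split: if_splits)

lemma run_cong: "(\<And>i. i \<in> {1..k} \<Longrightarrow> z i = z' i) \<Longrightarrow> run \<pi> x z k = run \<pi> x z' k"
proof (induction k)
  case (Suc k)
  have "run \<pi> x z k = run \<pi> x z' k" using Suc.prems by (intro Suc.IH) auto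
  moreover have "z (Suc k) = z' (Suc k)" using Suc.prems by auto
  ultimately show ?case by simp
qed simp

text \<open>
  A ruined state stays where it is, and before ruin payments only lower the reserve; hence only
  positive increments raise the positive part of the state.
\<close>

lemma state_le_sum_of_gains:
  assumes "\<pi> \<in> policies"
  shows "max (snd (run \<pi> x z N)) 0 \<le> max x 0 + (\<Sum>k\<in>{1..N}. max (z k) 0)"
proof (induction N)
  case (Suc N)
  have "max (snd (run \<pi> x z (Suc N))) 0 \<le> max (snd (run \<pi> x z N)) 0 + max (z (Suc N)) 0"
    using payout_nonneg[OF assms, of x z N] by (auto simp: run_Suc next_state_def max_def simp del: run.simps(2))
  moreover have "(\<Sum>k\<in>{1..Suc N}. max (z k) 0) = (\<Sum>k\<in>{1..N}. max (z k) 0) + max (z (Suc N)) 0"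
    by simp
  ultimately show ?case using Suc by linarith
qed simp

lemma measurable_run:
  assumes "\<And>i. i \<in> {1..k} \<Longrightarrow> X i \<in> measurable N (count_space UNIV)"
  shows "(\<lambda>\<omega>. run \<pi> x (\<lambda>i. X i \<omega>) k) \<in> measurable N (count_space UNIV)"
  using assms
proof (induction k)
  case (Suc k)
  have IH: "(\<lambda>\<omega>. run \<pi> x (\<lambda>i. X i \<omega>) k) \<in> measurable N (count_space UNIV)"
    by (rule Suc.IH, rule Suc.prems) simp
  have X: "X (Suc k) \<in> measurable N (count_space UNIV)" by (rule Suc.prems) simp
  define step where
    "step r z = (fst r @ [(snd r, \<pi> k (fst r) (snd r))], next_state (snd r) (\<pi> k (fst r) (snd r)) z)"
    for r :: "(int \<times> int) list \<times> int" and z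
  have "(\<lambda>\<omega>. step r (X (Suc k) \<omega>)) \<in> measurable N (count_space UNIV)" for r
    by (rule measurable_compose[OF X]) simp
  then have "(\<lambda>\<omega>. step (run \<pi> x (\<lambda>i. X i \<omega>) k) (X (Suc k) \<omega>)) \<in> measurable N (count_space UNIV)"
    by (rule measurable_compose_countable[OF _ IH])
  then show ?case
    by (simp only: run_Suc payout_eq step_def)
next
  case 0
  show ?case by (simp only: run.simps) (rule measurable_const, simp)
qed

lemma measurable_total_payout:
  assumes "\<And>i. 1 \<le> i \<Longrightarrow> X i \<in> measurable N (count_space UNIV)"
  shows "(\<lambda>\<omega>. total_payout \<beta> \<pi> x (\<lambda>i. X i \<omega>)) \<in> borel_measurable N"
proof -
  have "(\<lambda>\<omega>. ennreal (\<beta> ^ k * real_of_int (payout \<pi> x (\<lambda>i. X i \<omega>) k))) \<in> borel_measurable N" for k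
  proof -
    have "(\<lambda>\<omega>. run \<pi> x (\<lambda>i. X i \<omega>) k) \<in> measurable N (count_space UNIV)"
      by (rule measurable_run, rule assms) simp
    from measurable_compose[OF this, of "\<lambda>r. ennreal (\<beta> ^ k * real_of_int (\<pi> k (fst r) (snd r)))" borel]
    show ?thesis by (simp add: payout_eq)
  qed
  then show ?thesis unfolding total_payout_def by (rule borel_measurable_suminf_order)
qed

lemma measurable_exp_disutility: "exp_disutility \<theta> \<in> borel_measurable borel"
proof -
  have "(\<lambda>s. if s \<in> {\<infinity>} then 0 else exp (\<theta> * enn2real s)) \<in> borel_measurable borel"
    by (intro measurable_If_set borel_measurable_exp borel_measurable_times borel_measurable_enn2real) auto
  also have "(\<lambda>s. if s \<in> {\<infinity>} then 0 else exp (\<theta> * enn2real s)) = exp_disutility \<theta>"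
    by (auto simp: exp_disutility_def fun_eq_iff)
  finally show ?thesis .
qed

text \<open>
  The convention \<open>exp (-\<infinity>) = 0\<close> makes the disutility continuous along nondecreasing partial sums,
  also when the total diverges.
\<close>

lemma exp_disutility_of_partial_sums:
  fixes f :: "nat \<Rightarrow> real"
  assumes "\<theta> < 0" and "\<And>k. 0 \<le> f k"
  shows "(\<lambda>N. exp (\<theta> * sum f {..<N})) \<longlonglongrightarrow> exp_disutility \<theta> (\<Sum>k. ennreal (f k))"
proof (cases "(\<Sum>k. ennreal (f k)) = \<infinity>")
  case False
  then have "summable f" using assms by (intro summable_suminf_not_top) auto
  then have "f sums suminf f" by (rule summable_sums)
  moreover have "enn2real (\<Sum>k. ennreal (f k)) = suminf f"
    using \<open>summable f\<close> assms by (subst suminf_ennreal2) (simp_all add: suminf_nonneg)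
  ultimately show ?thesis
    using False by (auto simp: exp_disutility_def sums_def intro!: tendsto_intros)
next
  case True
  have "filterlim (\<lambda>N. sum f {..<N}) at_top sequentially"
  proof -
    have "(\<lambda>N. ennreal (sum f {..<N})) \<longlonglongrightarrow> \<infinity>"
      using summable_LIMSEQ[of "\<lambda>k. ennreal (f k)"] True assms(2) by (simp add: sum_ennreal)
    then have large: "\<forall>\<^sub>F N in sequentially. ennreal l < ennreal (sum f {..<N})" if "0 \<le> l" for l
      using that by (simp add: tendsto_top_iff_ennreal)
    have "\<forall>\<^sub>F N in sequentially. c < sum f {..<N}" for c
      using large[OF max.cobounded2[of 0 c]] 
      by eventually_elim (meson ennreal_leI leD max.cobounded1 not_le order_trans)
    then show ?thesis by (simp add: filterlim_at_top_dense)
  qed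
  then have "filterlim (\<lambda>N. \<theta> * sum f {..<N}) at_bot sequentially"
    using \<open>\<theta> < 0\<close> by (intro filterlim_tendsto_neg_mult_at_bot[OF tendsto_const])
  then show ?thesis
    using True by (simp add: exp_disutility_def filterlim_compose[OF exp_at_bot])
qed

section \<open>Verification\<close>

locale dividend_problem = dividend_recursion p \<beta> + prob_space M
  for p :: "int pmf" and \<beta> :: real and M :: "'w measure" +
  fixes Z :: "nat \<Rightarrow> 'w \<Rightarrow> int"
  assumes indep_Z: "indep_vars (\<lambda>_. count_space UNIV) Z {1..}"
    and distr_Z: "\<And>n. n \<ge> 1 \<Longrightarrow> distr M (count_space UNIV) (Z n) = measure_pmf p"
begin

abbreviation run_at :: "policy \<Rightarrow> int \<Rightarrow> nat \<Rightarrow> 'w \<Rightarrow> (int \<times> int) list \<times> int" where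
  "run_at \<pi> x N \<omega> \<equiv> run \<pi> x (\<lambda>n. Z n \<omega>) N"

definition disutility :: "policy \<Rightarrow> int \<Rightarrow> real \<Rightarrow> real" where
  "disutility \<pi> x \<theta> = expectation (\<lambda>\<omega>. exp_disutility \<theta> (total_payout \<beta> \<pi> x (\<lambda>n. Z n \<omega>)))"

text \<open>
  A history records the actions, so the discounted payments up to now are a function of the run.
  All expectations below are thus of functions of the pair of history and state, which takes
  countably many values.
\<close>

definition past_payout :: "(int \<times> int) list \<Rightarrow> real" where
  "past_payout h = (\<Sum>k<length h. \<beta> ^ k * real_of_int (snd (h ! k)))"

text \<open>
  Disutility of following \<open>\<pi>\<close> for \<open>N\<close> periods when the rest is charged at the limit value.
\<close>

definition continuation_value :: "policy \<Rightarrow> int \<Rightarrow> real \<Rightarrow> nat \<Rightarrow> real" where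
  "continuation_value \<pi> x \<theta> N = expectation (\<lambda>\<omega>. exp (\<theta> * past_payout (fst (run_at \<pi> x N \<omega>)))
     * limit_value (snd (run_at \<pi> x N \<omega>)) (\<theta> * \<beta> ^ N))"

lemma past_payout_append: "past_payout (h @ [(y, a)]) = past_payout h + \<beta> ^ length h * real_of_int a"
  by (simp add: past_payout_def nth_append)

lemma past_payout_run: "past_payout (fst (run \<pi> x z N)) = (\<Sum>k<N. \<beta> ^ k * real_of_int (payout \<pi> x z k))"
  by (induction N)
     (simp_all add: run_Suc past_payout_append length_run past_payout_def[of "[]"] del: run.simps(2))

lemma past_payout_run_nonneg: "\<pi> \<in> policies \<Longrightarrow> 0 \<le> past_payout (fst (run \<pi> x z N))"
  using payout_nonneg beta_pos by (simp add: past_payout_run sum_nonneg)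

lemma measurable_Z: "1 \<le> n \<Longrightarrow> Z n \<in> measurable M (count_space UNIV)"
  using indep_Z by (auto simp: indep_vars_def)

lemma measurable_run_at: "run_at \<pi> x N \<in> measurable M (count_space UNIV)"
  by (rule measurable_run) (simp add: measurable_Z)

lemma borel_measurable_run_at: "(\<lambda>\<omega>. f (run_at \<pi> x N \<omega>)) \<in> borel_measurable M"
  for f :: "_ \<Rightarrow> real"
  by (rule measurable_compose[OF measurable_run_at]) simp

lemma integrable_run_at:
  fixes f :: "_ \<Rightarrow> real"
  assumes "\<And>\<omega>. 0 \<le> f (run_at \<pi> x N \<omega>)" "\<And>\<omega>. f (run_at \<pi> x N \<omega>) \<le> 1"
  shows "integrable M (\<lambda>\<omega>. f (run_at \<pi> x N \<omega>))"
  by (rule integrable_const_bound[where B = 1])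
     (use assms in \<open>auto simp: borel_measurable_run_at\<close>)

text \<open>
  The run up to time \<open>N\<close> depends on the first \<open>N\<close> increments only, so it is independent of the next
  one, which can be integrated out first (Fubini).
\<close>

lemma expectation_next_step:
  fixes F :: "(int \<times> int) list \<times> int \<Rightarrow> int \<Rightarrow> real"
  assumes "\<And>\<omega> z. 0 \<le> F (run_at \<pi> x N \<omega>) z" "\<And>\<omega> z. F (run_at \<pi> x N \<omega>) z \<le> 1"
  shows "expectation (\<lambda>\<omega>. F (run_at \<pi> x N \<omega>) (Z (Suc N) \<omega>)) =
    expectation (\<lambda>\<omega>. measure_pmf.expectation p (F (run_at \<pi> x N \<omega>)))"
proof -
  let ?C = "\<lambda>_::nat. count_space (UNIV :: int set)"
  \<comment> \<open>The next increment is also viewed as a function on \<open>nat\<close>, which gives both random variables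
    the same type of values.\<close>
  let ?A = "PiM {1..N} ?C" and ?B = "PiM {Suc N} ?C"
  let ?X = "\<lambda>\<omega>. \<lambda>i\<in>{1..N}. Z i \<omega>" and ?Y = "\<lambda>\<omega>. \<lambda>i\<in>{Suc N}. Z i \<omega>"
  let ?H = "\<lambda>(u, v). F (run \<pi> x u N) (v (Suc N))"
  have "indep_var ?A ?X ?B ?Y" by (rule indep_var_restrict[OF indep_Z]) auto
  then have X: "?X \<in> measurable M ?A" and Y: "?Y \<in> measurable M ?B"
    and product: "distr M ?A ?X \<Otimes>\<^sub>M distr M ?B ?Y = distr M (?A \<Otimes>\<^sub>M ?B) (\<lambda>\<omega>. (?X \<omega>, ?Y \<omega>))"
    by (simp_all only: indep_var_distribution_eq)
  interpret X: prob_space "distr M ?A ?X" by (rule prob_space_distr[OF X])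
  interpret Y: prob_space "distr M ?B ?Y" by (rule prob_space_distr[OF Y])
  interpret P: pair_sigma_finite "distr M ?A ?X" "distr M ?B ?Y" ..
  have run_X: "run \<pi> x (?X \<omega>) N = run_at \<pi> x N \<omega>" for \<omega>
    by (rule run_cong) auto
  have pair: "(\<lambda>\<omega>. (?X \<omega>, ?Y \<omega>)) \<in> measurable M (?A \<Otimes>\<^sub>M ?B)" using X Y by simp
  have run: "(\<lambda>u. run \<pi> x u N) \<in> measurable ?A (count_space UNIV)"
    using measurable_run[of N "\<lambda>i u. u i" ?A] by (simp add: measurable_component_singleton)
  have last: "(\<lambda>v. v (Suc N)) \<in> measurable ?B (count_space UNIV)"
    by (rule measurable_component_singleton) simp
  have "(\<lambda>w. F r (snd w (Suc N))) \<in> borel_measurable (?A \<Otimes>\<^sub>M ?B)" for r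
    by (rule measurable_compose[OF measurable_compose[OF measurable_snd last]]) simp
  from measurable_compose_countable[OF this measurable_compose[OF measurable_fst run]]
  have H: "?H \<in> borel_measurable (?A \<Otimes>\<^sub>M ?B)" by (simp add: split_beta)
  have H_path: "?H (?X \<omega>, ?Y \<omega>) = F (run_at \<pi> x N \<omega>) (Z (Suc N) \<omega>)" for \<omega>
    by (simp only: prod.case run_X) simp
  have "integrable M (\<lambda>\<omega>. ?H (?X \<omega>, ?Y \<omega>))"
    using assms by (intro integrable_const_bound[where B = 1] measurable_compose[OF pair H])
      (simp only: H_path, simp)
  then have integrable: "integrable (distr M ?A ?X \<Otimes>\<^sub>M distr M ?B ?Y) ?H"
    by (simp only: product integrable_distr_eq[OF pair H])
  have inner: "(\<integral>v. F r (v (Suc N)) \<partial>distr M ?B ?Y) = measure_pmf.expectation p (F r)" for r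
  proof -
    have "(\<integral>v. F r (v (Suc N)) \<partial>distr M ?B ?Y) = expectation (\<lambda>\<omega>. F r (Z (Suc N) \<omega>))"
      by (subst integral_distr[OF Y]) (simp_all add: measurable_compose[OF last])
    also have "\<dots> = (\<integral>z. F r z \<partial>distr M (count_space UNIV) (Z (Suc N)))"
      by (rule integral_distr[symmetric]) (simp_all add: measurable_Z)
    finally show ?thesis by (simp add: distr_Z)
  qed
  have "expectation (\<lambda>\<omega>. F (run_at \<pi> x N \<omega>) (Z (Suc N) \<omega>))
      = integral\<^sup>L (distr M ?A ?X \<Otimes>\<^sub>M distr M ?B ?Y) ?H"
    by (simp only: product integral_distr[OF pair H] H_path)
  also have "\<dots> = (\<integral>u. \<integral>v. F (run \<pi> x u N) (v (Suc N)) \<partial>distr M ?B ?Y \<partial>distr M ?A ?X)"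
    using P.integral_fst'[OF integrable] by simp
  also have "\<dots> = (\<integral>u. measure_pmf.expectation p (F (run \<pi> x u N)) \<partial>distr M ?A ?X)"
    by (simp only: inner)
  also have "\<dots> = expectation (\<lambda>\<omega>. measure_pmf.expectation p (F (run \<pi> x (?X \<omega>) N)))"
    by (intro integral_distr[OF X] measurable_compose[OF run]) simp
  finally show ?thesis by (simp only: run_X)
qed

lemma later_discount_nonpos: "\<theta> \<le> 0 \<Longrightarrow> \<theta> * \<beta> ^ N \<le> 0"
  using beta_pos by (simp add: mult_nonpos_nonneg)

lemma weighted_value_bounds:
  assumes "\<theta> \<le> 0" "\<pi> \<in> policies"
  shows "0 \<le> exp (\<theta> * past_payout (fst (run \<pi> x z N))) * limit_value y (\<theta> * \<beta> ^ K)"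
    and "exp (\<theta> * past_payout (fst (run \<pi> x z N))) * limit_value y (\<theta> * \<beta> ^ K) \<le> 1"
  using assms limit_value_nonneg[OF later_discount_nonpos] limit_value_bounds(2)[OF later_discount_nonpos]
    past_payout_run_nonneg by (auto intro!: mult_le_one simp: mult_nonpos_nonneg)

text \<open>
  Every decision minimises the cost in the optimality equation, at the risk parameter reached by
  discounting \<open>\<theta>\<close> over the periods elapsed.
\<close>

definition conserving :: "policy \<Rightarrow> real \<Rightarrow> bool" where
  "conserving \<pi> \<theta> \<longleftrightarrow> (\<forall>k h y. 0 \<le> y \<longrightarrow> (\<forall>b\<in>{0..y}.
     stage_cost limit_value y (\<theta> * \<beta> ^ k) (\<pi> k h y) \<le> stage_cost limit_value y (\<theta> * \<beta> ^ k) b))"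

text \<open>
  Integrating out the next increment turns the limit value at the next state into the stage cost of
  the decision taken. By the optimality equation this is at least the limit value at the current
  state, with equality for minimising decisions.
\<close>

lemma continuation_value_Suc:
  assumes "\<theta> \<le> 0" "\<pi> \<in> policies"
  shows "continuation_value \<pi> x \<theta> N \<le> continuation_value \<pi> x \<theta> (Suc N)"
    and "conserving \<pi> \<theta> \<Longrightarrow> continuation_value \<pi> x \<theta> (Suc N) = continuation_value \<pi> x \<theta> N"
proof -
  let ?t = "\<theta> * \<beta> ^ N"
  let ?pay = "\<lambda>\<omega>. payout \<pi> x (\<lambda>n. Z n \<omega>) N"
  let ?past = "\<lambda>\<omega>. exp (\<theta> * past_payout (fst (run_at \<pi> x N \<omega>)))"
  let ?state = "\<lambda>\<omega>. snd (run_at \<pi> x N \<omega>)"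
  define F where "F r z = exp (\<theta> * past_payout (fst r @ [(snd r, \<pi> N (fst r) (snd r))]))
      * limit_value (next_state (snd r) (\<pi> N (fst r) (snd r)) z) (\<theta> * \<beta> ^ Suc N)" for r z
  have nonpos: "?t \<le> 0" using assms(1) by (rule later_discount_nonpos)
  have feasible: "?pay \<omega> \<in> actions (?state \<omega>)" for \<omega> using assms(2) by (rule run_admissible)
  have "0 \<le> F (run_at \<pi> x N \<omega>) z \<and> F (run_at \<pi> x N \<omega>) z \<le> 1" for \<omega> z
  proof -
    have "fst (run_at \<pi> x N \<omega>) @ [(?state \<omega>, \<pi> N (fst (run_at \<pi> x N \<omega>)) (?state \<omega>))]
        = fst (run_at \<pi> x (Suc N) \<omega>)"
      by (simp add: run_Suc payout_eq del: run.simps(2))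
    then show ?thesis unfolding F_def using weighted_value_bounds[OF assms] by metis
  qed
  note next_step = expectation_next_step[of F \<pi> x N, OF this[THEN conjunct1] this[THEN conjunct2]]
  have "continuation_value \<pi> x \<theta> (Suc N) = expectation (\<lambda>\<omega>. F (run_at \<pi> x N \<omega>) (Z (Suc N) \<omega>))"
    unfolding continuation_value_def F_def by (simp add: run_Suc payout_eq del: run.simps(2))
  note Suc_eq = this[unfolded next_step]
  have mean_F: "measure_pmf.expectation p (F (run_at \<pi> x N \<omega>)) = ?past \<omega> *
      (if 0 \<le> ?state \<omega> then stage_cost limit_value (?state \<omega>) ?t (?pay \<omega>) else 1)" for \<omega>
  proof -
    have exp_eq: "exp (\<theta> * past_payout (fst (run_at \<pi> x N \<omega>) @ [(?state \<omega>, ?pay \<omega>)]))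
        = ?past \<omega> * exp (?t * ?pay \<omega>)"
      by (simp add: past_payout_append length_run exp_add[symmetric] algebra_simps)
    have "\<theta> * \<beta> ^ Suc N = ?t * \<beta>" by simp
    then have "F (run_at \<pi> x N \<omega>) = (\<lambda>z. ?past \<omega> *
        (exp (?t * ?pay \<omega>) * limit_value (next_state (?state \<omega>) (?pay \<omega>) z) (?t * \<beta>)))"
      unfolding F_def payout_eq[symmetric] exp_eq by (simp add: fun_eq_iff mult_ac)
    then show ?thesis
      using feasible[of \<omega>]
      by (auto simp: stage_cost_def next_state_def actions_def limit_value_ruined)
  qed
  have le: "limit_value (?state \<omega>) ?t \<le>
      (if 0 \<le> ?state \<omega> then stage_cost limit_value (?state \<omega>) ?t (?pay \<omega>) else 1)" for \<omega>
    using feasible[of \<omega>] limit_value_le_stage_cost[OF nonpos]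
    by (auto simp: actions_def limit_value_ruined)
  show "continuation_value \<pi> x \<theta> N \<le> continuation_value \<pi> x \<theta> (Suc N)"
    unfolding Suc_eq unfolding continuation_value_def
  proof (rule integral_mono)
    show "integrable M (\<lambda>\<omega>. ?past \<omega> * limit_value (?state \<omega>) ?t)"
      using weighted_value_bounds[OF assms] by (intro integrable_run_at) auto
    show "integrable M (\<lambda>\<omega>. measure_pmf.expectation p (F (run_at \<pi> x N \<omega>)))"
      using \<open>\<And>\<omega> z. 0 \<le> F (run_at \<pi> x N \<omega>) z \<and> F (run_at \<pi> x N \<omega>) z \<le> 1\<close>
      by (intro integrable_run_at expectation_unit_interval) auto
    show "?past \<omega> * limit_value (?state \<omega>) ?t \<le> measure_pmf.expectation p (F (run_at \<pi> x N \<omega>))" for \<omega>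
      unfolding mean_F by (intro mult_left_mono le) simp
  qed
  show "continuation_value \<pi> x \<theta> (Suc N) = continuation_value \<pi> x \<theta> N" if "conserving \<pi> \<theta>"
  proof -
    have "limit_value (?state \<omega>) ?t =
        (if 0 \<le> ?state \<omega> then stage_cost limit_value (?state \<omega>) ?t (?pay \<omega>) else 1)" for \<omega>
      using feasible[of \<omega>] that
      by (auto simp: actions_def limit_value_ruined conserving_def payout_eq
          intro!: limit_value_eq_minimal_stage_cost[OF nonpos])
    then show ?thesis unfolding Suc_eq mean_F unfolding continuation_value_def by simp
  qed
qed

lemma continuation_value_0: "continuation_value \<pi> x \<theta> 0 = limit_value x \<theta>"
  by (simp add: continuation_value_def past_payout_def prob_space)

text \<open>
  The disutility of the payments in the first \<open>N\<close> periods decreases to that of all payments.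
\<close>

lemma disutility_tendsto:
  assumes "\<theta> < 0" "\<pi> \<in> policies"
  shows "(\<lambda>N. expectation (\<lambda>\<omega>. exp (\<theta> * past_payout (fst (run_at \<pi> x N \<omega>))))) \<longlonglongrightarrow> disutility \<pi> x \<theta>"
  unfolding disutility_def
proof (rule integral_dominated_convergence[where w = "\<lambda>_. 1"])
  show "(\<lambda>\<omega>. exp_disutility \<theta> (total_payout \<beta> \<pi> x (\<lambda>n. Z n \<omega>))) \<in> borel_measurable M"
    by (intro measurable_compose[OF measurable_total_payout measurable_exp_disutility] measurable_Z)
  show "AE \<omega> in M. (\<lambda>N. exp (\<theta> * past_payout (fst (run_at \<pi> x N \<omega>))))
      \<longlonglongrightarrow> exp_disutility \<theta> (total_payout \<beta> \<pi> x (\<lambda>n. Z n \<omega>))"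
    unfolding total_payout_def past_payout_run
    using assms beta_pos payout_nonneg by (intro AE_I2 exp_disutility_of_partial_sums) auto
  show "AE \<omega> in M. norm (exp (\<theta> * past_payout (fst (run_at \<pi> x N \<omega>)))) \<le> 1" for N
    using assms past_payout_run_nonneg by (auto simp: mult_nonpos_nonneg)
  show "(\<lambda>\<omega>. exp (\<theta> * past_payout (fst (run_at \<pi> x N \<omega>)))) \<in> borel_measurable M" for N
    by (rule borel_measurable_run_at[where f = "\<lambda>r. exp (\<theta> * past_payout (fst r))"])
qed simp_all

lemma limit_value_le_disutility:
  assumes "\<theta> < 0" "\<pi> \<in> policies"
  shows "limit_value x \<theta> \<le> disutility \<pi> x \<theta>"
proof (rule LIMSEQ_le_const[OF disutility_tendsto[OF assms]], intro exI[of _ 0] allI impI)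
  fix N
  have nonpos: "\<theta> \<le> 0" using assms by simp
  have "limit_value x \<theta> \<le> continuation_value \<pi> x \<theta> N"
  proof (induction N)
    case (Suc N)
    then show ?case using continuation_value_Suc(1)[OF nonpos assms(2)] by (rule order_trans)
  qed (simp add: continuation_value_0)
  also have "\<dots> \<le> expectation (\<lambda>\<omega>. exp (\<theta> * past_payout (fst (run_at \<pi> x N \<omega>))))"
    unfolding continuation_value_def
  proof (rule integral_mono)
    show "integrable M (\<lambda>\<omega>. exp (\<theta> * past_payout (fst (run_at \<pi> x N \<omega>)))
        * limit_value (snd (run_at \<pi> x N \<omega>)) (\<theta> * \<beta> ^ N))"
      using weighted_value_bounds[OF nonpos assms(2)] by (intro integrable_run_at) auto
    show "integrable M (\<lambda>\<omega>. exp (\<theta> * past_payout (fst (run_at \<pi> x N \<omega>))))"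
      using nonpos past_payout_run_nonneg[OF assms(2)]
      by (intro integrable_run_at) (auto simp: mult_nonpos_nonneg)
  qed (simp add: mult_left_le limit_value_bounds(2)[OF later_discount_nonpos[OF nonpos]])
  finally show "limit_value x \<theta> \<le> expectation (\<lambda>\<omega>. exp (\<theta> * past_payout (fst (run_at \<pi> x N \<omega>))))" .
qed

lemma
  assumes "1 \<le> k"
  shows integrable_gain: "integrable M (\<lambda>\<omega>. real_of_int (max (Z k \<omega>) 0))"
    and expectation_gain: "expectation (\<lambda>\<omega>. real_of_int (max (Z k \<omega>) 0)) = mean_pos"
proof -
  have "integrable (distr M (count_space UNIV) (Z k)) (\<lambda>z. real_of_int (max z 0))"
    using integrable_pos_part distr_Z[OF assms] by simp
  then show "integrable M (\<lambda>\<omega>. real_of_int (max (Z k \<omega>) 0))"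
    by (subst (asm) integrable_distr_eq[OF measurable_Z[OF assms]]) auto
  have "mean_pos = (\<integral>z. real_of_int (max z 0) \<partial>distr M (count_space UNIV) (Z k))"
    by (simp add: mean_pos_def distr_Z[OF assms])
  then show "expectation (\<lambda>\<omega>. real_of_int (max (Z k \<omega>) 0)) = mean_pos"
    by (simp add: integral_distr[OF measurable_Z[OF assms]])
qed

text \<open>
  The two quantities differ by the factor \<open>limit_value\<close>, which the exponential lower bound keeps
  close to 1: \<open>1 - exp t \<le> - t\<close>, and the state reached has a mean of at most the initial state plus
  \<open>N * mean_pos\<close>.
\<close>

lemma remaining_value_gap:
  assumes "\<theta> \<le> 0" "\<pi> \<in> policies"
  shows "expectation (\<lambda>\<omega>. exp (\<theta> * past_payout (fst (run_at \<pi> x N \<omega>)))) - continuation_value \<pi> x \<theta> N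
    \<le> - \<theta> * \<beta> ^ N * (real_of_int (max x 0) + real N * mean_pos + slack)"
proof -
  let ?t = "\<theta> * \<beta> ^ N"
  let ?past = "\<lambda>\<omega>. exp (\<theta> * past_payout (fst (run_at \<pi> x N \<omega>)))"
  let ?w = "\<lambda>\<omega>. limit_value (snd (run_at \<pi> x N \<omega>)) ?t"
  let ?bound = "\<lambda>\<omega>. - ?t * (real_of_int (max x 0) + (\<Sum>k\<in>{1..N}. real_of_int (max (Z k \<omega>) 0)) + slack)"
  have nonpos: "?t \<le> 0" using assms(1) by (rule later_discount_nonpos)
  have past_le: "?past \<omega> \<le> 1" for \<omega>
    using assms(1) past_payout_run_nonneg[OF assms(2)] by (simp add: mult_nonpos_nonneg)
  have int_past: "integrable M ?past"
    using past_le by (intro integrable_run_at) auto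
  have int_w: "integrable M (\<lambda>\<omega>. ?past \<omega> * ?w \<omega>)"
    using weighted_value_bounds[OF assms] by (intro integrable_run_at) auto
  have int_sum: "integrable M (\<lambda>\<omega>. \<Sum>k\<in>{1..N}. real_of_int (max (Z k \<omega>) 0))"
    by (intro Bochner_Integration.integrable_sum integrable_gain) simp
  then have int_bound: "integrable M ?bound"
    by (intro integrable_mult_right integrable_add) auto
  have one_minus_exp_le: "1 - exp s \<le> - s" for s :: real
    using exp_ge_add_one_self[of s] by linarith
  have le: "?past \<omega> - ?past \<omega> * ?w \<omega> \<le> ?bound \<omega>" for \<omega>
  proof -
    let ?y = "real_of_int (max (snd (run_at \<pi> x N \<omega>)) 0)"
    have w: "0 \<le> 1 - ?w \<omega>" using limit_value_bounds(2)[OF nonpos] by simp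
    have "?past \<omega> - ?past \<omega> * ?w \<omega> = ?past \<omega> * (1 - ?w \<omega>)" by (simp add: right_diff_distrib)
    also have "\<dots> \<le> 1 - ?w \<omega>" using mult_right_mono[OF past_le w] by simp
    also have "\<dots> \<le> 1 - exp (?t * (?y + slack))"
      using limit_value_bounds(1)[OF nonpos] by simp
    also have "\<dots> \<le> - ?t * (?y + slack)"
      unfolding mult_minus_left by (rule one_minus_exp_le)
    also have "\<dots> \<le> ?bound \<omega>"
    proof (rule mult_left_mono)
      have "?y \<le> real_of_int (max x 0 + (\<Sum>k\<in>{1..N}. max (Z k \<omega>) 0))"
        by (simp only: of_int_le_iff state_le_sum_of_gains[OF assms(2)])
      then show "?y + slack
          \<le> real_of_int (max x 0) + (\<Sum>k\<in>{1..N}. real_of_int (max (Z k \<omega>) 0)) + slack"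
        by simp
    qed (use nonpos in simp)
    finally show ?thesis .
  qed
  have "expectation ?past - continuation_value \<pi> x \<theta> N = expectation (\<lambda>\<omega>. ?past \<omega> - ?past \<omega> * ?w \<omega>)"
    unfolding continuation_value_def using int_past int_w by simp
  also have "\<dots> \<le> expectation ?bound"
    using le int_past int_w by (intro integral_mono int_bound Bochner_Integration.integrable_diff) auto
  also have "\<dots> = - ?t * (real_of_int (max x 0) + real N * mean_pos + slack)"
  proof -
    have "expectation (\<lambda>\<omega>. \<Sum>k\<in>{1..N}. real_of_int (max (Z k \<omega>) 0)) = real N * mean_pos"
      by (subst Bochner_Integration.integral_sum) (simp_all add: integrable_gain expectation_gain del: of_int_max)
    then show ?thesis using int_sum by (simp add: prob_space del: of_int_max)
  qed
  finally show ?thesis by simp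
qed

lemma disutility_of_conserving:
  assumes "\<theta> < 0" "\<pi> \<in> policies" "conserving \<pi> \<theta>"
  shows "disutility \<pi> x \<theta> = limit_value x \<theta>"
proof (rule antisym)
  have nonpos: "\<theta> \<le> 0" using assms by simp
  have "continuation_value \<pi> x \<theta> N = limit_value x \<theta>" for N
    by (induction N) (simp_all add: continuation_value_0 continuation_value_Suc(2)[OF nonpos assms(2,3)])
  then have le: "expectation (\<lambda>\<omega>. exp (\<theta> * past_payout (fst (run_at \<pi> x N \<omega>))))
      \<le> limit_value x \<theta> + - \<theta> * (\<beta> ^ N * (real_of_int (max x 0) + slack) + mean_pos * (real N * \<beta> ^ N))" for N
    using remaining_value_gap[OF nonpos assms(2), of x N] by (simp add: algebra_simps)
  have "norm \<beta> < 1" using beta_pos beta_less_1 by simp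
  then have "(\<lambda>N. \<beta> ^ N) \<longlonglongrightarrow> 0" "(\<lambda>N. real N * \<beta> ^ N) \<longlonglongrightarrow> 0"
    by (rule LIMSEQ_power_zero, rule powser_times_n_limit_0)
  then have "(\<lambda>N. limit_value x \<theta> + - \<theta> * (\<beta> ^ N * (real_of_int (max x 0) + slack) + mean_pos * (real N * \<beta> ^ N)))
      \<longlonglongrightarrow> limit_value x \<theta> + - \<theta> * (0 * (real_of_int (max x 0) + slack) + mean_pos * 0)"
    by (intro tendsto_intros \<open>norm \<beta> < 1\<close>)
  then show "disutility \<pi> x \<theta> \<le> limit_value x \<theta>"
    using LIMSEQ_le[OF disutility_tendsto[OF assms(1,2)]] le by fastforce
  show "limit_value x \<theta> \<le> disutility \<pi> x \<theta>"
    using assms(1,2) by (rule limit_value_le_disutility)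
qed

lemma markov_policy_in_policies: "(\<And>k y. g k y \<in> actions y) \<Longrightarrow> markov_policy g \<in> policies"
  by (simp add: policies_def markov_policy_def)

lemma finite_actions: "finite (actions x)" and actions_nonempty: "actions x \<noteq> {}"
  by (auto simp: actions_def)

lemma exists_conserving_policy: "\<exists>\<pi>\<in>policies. conserving \<pi> \<theta>"
proof -
  define g where "g k y = arg_min_on (stage_cost limit_value y (\<theta> * \<beta> ^ k)) (actions y)" for k y
  have "g k y \<in> actions y" for k y
    unfolding g_def by (rule arg_min_if_finite[OF finite_actions actions_nonempty])
  moreover have "stage_cost limit_value y (\<theta> * \<beta> ^ k) (g k y) \<le> stage_cost limit_value y (\<theta> * \<beta> ^ k) b"
    if "b \<in> actions y" for k y b
    using arg_min_least[OF finite_actions actions_nonempty that] by (simp add: g_def)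
  ultimately show ?thesis
    by (intro bexI[of _ "markov_policy g"] markov_policy_in_policies)
       (auto simp: conserving_def markov_policy_def actions_def)
qed

lemma J_eq_limit_value: "\<theta> < 0 \<Longrightarrow> J M Z \<beta> x \<theta> = limit_value x \<theta>"
proof -
  assume "\<theta> < 0"
  obtain \<pi> where "\<pi> \<in> policies" "conserving \<pi> \<theta>" using exists_conserving_policy by blast
  then have attained: "limit_value x \<theta> = disutility \<pi> x \<theta>"
    using \<open>\<theta> < 0\<close> by (simp add: disutility_of_conserving)
  show ?thesis
    unfolding J_def disutility_def[symmetric]
  proof (rule cInf_eq_minimum)
    show "limit_value x \<theta> \<in> (\<lambda>\<pi>. disutility \<pi> x \<theta>) ` policies"
      by (intro image_eqI[where x = \<pi>] attained \<open>\<pi> \<in> policies\<close>)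
  qed (auto intro: limit_value_le_disutility[OF \<open>\<theta> < 0\<close>])
qed

end

section \<open>Band functions and finite sets\<close>

text \<open>
  The blocks of consecutive points of \<open>A\<close> are \<open>{..c 0}\<close> and \<open>{d k..c k}\<close> for \<open>1 \<le> k \<le> n\<close>, in
  increasing order.
\<close>

definition band_breakpoints :: "nat set \<Rightarrow> nat \<Rightarrow> (nat \<Rightarrow> nat) \<Rightarrow> (nat \<Rightarrow> nat) \<Rightarrow> bool" where
  "band_breakpoints A n c d \<longleftrightarrow>
     c n = Max A \<and>
     (\<forall>k\<in>{1..n}. c (k - 1) + 2 \<le> d k \<and> d k \<le> c k) \<and>
     {..c 0} \<subseteq> A \<and>
     (\<forall>k<n. \<forall>x. c k < x \<and> x < d (k + 1) \<longrightarrow> c k \<in> A \<and> x \<notin> A) \<and>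
     (\<forall>k\<in>{1..n}. {d k..c k} \<subseteq> A)"

lemma band_breakpointsD:
  assumes "band_breakpoints A n c d"
  shows "c n = Max A"
    and "k \<in> {1..n} \<Longrightarrow> c (k - 1) + 2 \<le> d k \<and> d k \<le> c k"
    and "{..c 0} \<subseteq> A"
    and "k < n \<Longrightarrow> c k < x \<Longrightarrow> x < d (k + 1) \<Longrightarrow> c k \<in> A \<and> x \<notin> A"
    and "k \<in> {1..n} \<Longrightarrow> {d k..c k} \<subseteq> A"
  using assms unfolding band_breakpoints_def by simp_all

lemma band_breakpointsI:
  assumes "c n = Max A"
    and "\<And>k. k \<in> {1..n} \<Longrightarrow> c (k - 1) + 2 \<le> d k \<and> d k \<le> c k"
    and "{..c 0} \<subseteq> A"
    and "\<And>k x. k < n \<Longrightarrow> c k < x \<Longrightarrow> x < d (k + 1) \<Longrightarrow> c k \<in> A \<and> x \<notin> A"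
    and "\<And>k. k \<in> {1..n} \<Longrightarrow> {d k..c k} \<subseteq> A"
  shows "band_breakpoints A n c d"
  using assms unfolding band_breakpoints_def by blast

text \<open>
  Insert the points in increasing order: a new point either extends the last block by one or, if it
  leaves a gap, opens a new block.
\<close>

lemma band_breakpoints_exist:
  fixes A :: "nat set"
  assumes "finite A" and "0 \<in> A"
  shows "\<exists>n c d. band_breakpoints A n c d"
  using assms
proof (induction A rule: finite_linorder_max_induct)
  case (insert b A)
  show ?case
  proof (cases "A = {}")
    case True
    with insert.prems have singleton: "insert b A = {0}" by auto
    show ?thesis
      unfolding singleton
      by (intro exI[of _ 0] exI[of _ "\<lambda>_. 0"] band_breakpointsI) auto
  next
    case False
    then obtain a where "a \<in> A" by blast
    then have "a < b" using insert(2) by blast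
    then have "0 \<in> A" using insert.prems by auto
    then obtain n c d where "band_breakpoints A n c d" using insert.IH by blast
    note top = band_breakpointsD(1)[OF this] and gap = band_breakpointsD(2)[OF this]
      and first = band_breakpointsD(3)[OF this] and pay = band_breakpointsD(4)[OF this]
      and keep = band_breakpointsD(5)[OF this]
    have below: "y \<le> c n" if "y \<in> A" for y using that top insert(1) by simp
    have "c n \<in> A" using top insert(1) False by simp
    then have "c n < b" using insert(2) by blast
    have Max_b: "Max (insert b A) = b" using insert(1,2) by (intro Max_eqI) (auto intro: less_imp_le)
    have d_le: "d (k + 1) \<le> b" if "k < n" for k
    proof -
      have "d (k + 1) \<le> c (k + 1)" using gap[of "k+1"] that by simp
      moreover have "c (k+1) \<in> A" using keep[of "k+1"] that calculation by auto
      ultimately show ?thesis using below \<open>c n < b\<close> by (meson le_trans less_imp_le)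
    qed
    show ?thesis
    proof (cases "b = c n + 1")
      case True
      let ?c = "c(n := b)"
      have "band_breakpoints (insert b A) n ?c d"
      proof (rule band_breakpointsI)
        show "?c n = Max (insert b A)" using Max_b by simp
        show "?c (k - 1) + 2 \<le> d k \<and> d k \<le> ?c k" if "k \<in> {1..n}" for k
          using gap[OF that] that \<open>c n < b\<close> by auto
        show "{..?c 0} \<subseteq> insert b A"
          using first True by (cases "n = 0") (auto simp: le_Suc_eq)
        show "?c k \<in> insert b A \<and> x \<notin> insert b A" if "k < n" "?c k < x" "x < d (k + 1)" for k x
          using pay[of k x] that d_le[of k] by auto
        show "{d k..?c k} \<subseteq> insert b A" if "k \<in> {1..n}" for k
          using keep[OF that] True by (cases "k = n") (auto simp: le_Suc_eq)
      qed
      then show ?thesis by blast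
    next
      case far: False
      let ?c = "c(Suc n := b)" and ?d = "d(Suc n := b)"
      have "band_breakpoints (insert b A) (Suc n) ?c ?d"
      proof (rule band_breakpointsI)
        show "?c (Suc n) = Max (insert b A)" using Max_b by simp
        show "?c (k - 1) + 2 \<le> ?d k \<and> ?d k \<le> ?c k" if "k \<in> {1..Suc n}" for k
          using gap[of k] that \<open>c n < b\<close> far by (cases "k = Suc n") auto
        show "{..?c 0} \<subseteq> insert b A" using first by auto
        show "?c k \<in> insert b A \<and> x \<notin> insert b A"
          if "k < Suc n" "?c k < x" "x < ?d (k + 1)" for k x
        proof (cases "k = n")
          case True
          then show ?thesis using that below[of x] \<open>c n \<in> A\<close> by auto
        next
          case False
          then show ?thesis using that pay[of k x] d_le[of k] by auto
        qed
        show "{?d k..?c k} \<subseteq> insert b A" if "k \<in> {1..Suc n}" for k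
          using keep[of k] that by (cases "k = Suc n") auto
      qed
      then show ?thesis by blast
    qed
  qed
qed simp

text \<open>
  Inside a block the last point is the state itself and nothing is paid; in a gap, and beyond the
  last block, it is the end of the preceding block.
\<close>

lemma band_function_if_last_point_of_finite_set:
  fixes A :: "nat set"
  assumes "finite A" and "0 \<in> A"
    and ruined: "\<And>x. x < 0 \<Longrightarrow> g x = 0"
    and last: "\<And>x. g (int x) = int x - int (Max {y \<in> A. y \<le> x})"
  shows "band_function g"
proof -
  obtain n c d where "band_breakpoints A n c d"
    using band_breakpoints_exist[OF assms(1,2)] by blast
  note top = band_breakpointsD(1)[OF this] and gap = band_breakpointsD(2)[OF this]
    and first = band_breakpointsD(3)[OF this] and pay = band_breakpointsD(4)[OF this]
    and keep = band_breakpointsD(5)[OF this]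
  have fin: "finite {y \<in> A. y \<le> x}" for x using \<open>finite A\<close> by simp
  have eq: "g (int x) = int x - int m" if "m \<in> A" "m \<le> x" "\<And>y. y \<in> A \<Longrightarrow> y \<le> x \<Longrightarrow> y \<le> m" for x m
  proof -
    have "Max {y \<in> A. y \<le> x} = m" using that fin by (intro Max_eqI) auto
    then show ?thesis by (simp add: last)
  qed
  have zero: "g (int x) = 0" if "x \<in> A" for x using eq[of x x] that by simp
  have "g x \<in> actions x" for x
  proof (cases "x < 0")
    case False
    then obtain y where y: "x = int y" by (metis nonneg_int_cases not_less)
    have "Max {z \<in> A. z \<le> y} \<in> {z \<in> A. z \<le> y}" using \<open>0 \<in> A\<close> fin by (intro Max_in) auto
    then show ?thesis by (simp add: y last actions_def)
  qed (simp add: ruined actions_def)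
  then have "g \<in> decision_rules" by (simp add: decision_rules_def)
  moreover have "int (d k) - int (c (k - 1)) \<ge> 2" "c (k - 1) \<le> d k" "d k \<le> c k" if "k \<in> {1..n}" for k
    using gap[OF that] by linarith+
  moreover have "g x = 0" if "x \<le> int (c 0)" for x
  proof (cases "x < 0")
    case False
    then have "nat x \<in> A" using first that by auto
    then show ?thesis using zero[of "nat x"] False by simp
  qed (rule ruined)
  moreover have "g x = x - int (c k)" if "k < n" "int (c k) < x" "x < int (d (k + 1))" for k x
  proof -
    have "g (int (nat x)) = int (nat x) - int (c k)"
    proof (rule eq)
      show "c k \<in> A" using pay[of k "nat x"] that by auto
      show "c k \<le> nat x" using that by auto
      show "y \<le> c k" if y: "y \<in> A" "y \<le> nat x" for y
      proof (rule ccontr)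
        assume "\<not> y \<le> c k"
        then have "y \<notin> A" using y \<open>k < n\<close> \<open>x < int (d (k + 1))\<close> pay[of k y] by linarith
        with y show False by simp
      qed
    qed
    then show ?thesis using that by simp
  qed
  moreover have "g x = 0" if "k \<in> {1..n}" "int (d k) \<le> x" "x \<le> int (c k)" for k x
  proof -
    have "nat x \<in> {d k..c k}" using that by auto
    then have "nat x \<in> A" using keep[OF that(1)] by blast
    then show ?thesis using zero[of "nat x"] that by simp
  qed
  moreover have "g x = x - int (c n)" if "x > int (c n)" for x
  proof -
    have "g (int (nat x)) = int (nat x) - int (c n)"
      using top \<open>finite A\<close> \<open>0 \<in> A\<close> that by (intro eq) (auto intro: Max_in)
    then show ?thesis using that by simp
  qed
  ultimately show ?thesis
    unfolding band_function_def by (intro conjI exI[of _ n] exI[of _ c] exI[of _ d]) auto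
qed

section \<open>Structure of the optimal decisions\<close>

context dividend_problem
begin

text \<open>
  After ruin the limit value is 1, so the two sums in \<open>G\<close> are the parts of one expectation.
\<close>

lemma G_eq_expectation:
  assumes "\<theta> < 0"
  shows "G M Z (pmf p) \<beta> x \<theta> = measure_pmf.expectation p (\<lambda>z. limit_value (x + z) \<theta>)"
proof -
  let ?f = "\<lambda>k. pmf p k * limit_value (x + k) \<theta>"
  have bound: "norm (?f k) \<le> norm (pmf p k)" for k
    using limit_value_bounds(2)[of \<theta> "x + k"] limit_value_nonneg[of \<theta> "x + k"] assms
    by (simp add: abs_mult mult_left_le)
  have abs: "Infinite_Set_Sum.abs_summable_on ?f A" for A
    by (rule abs_summable_on_comparison_test'[OF pmf_abs_summable]) (use bound in simp)
  have "(UNIV :: int set) = {- x..} \<union> {..- x - 1}" by auto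
  then have "measure_pmf.expectation p (\<lambda>z. limit_value (x + z) \<theta>) = infsetsum ?f ({- x..} \<union> {..- x - 1})"
    by (simp add: pmf_expectation_eq_infsetsum)
  also have "\<dots> = infsetsum ?f {- x..} + infsetsum ?f {..- x - 1}"
    by (rule infsetsum_Un_disjoint) (auto intro: abs)
  also have "\<dots> = infsum ?f {- x..} + infsum ?f {..- x - 1}"
    by (simp only: infsetsum_infsum[OF abs])
  also have "infsum ?f {- x..} = (\<Sum>\<^sub>\<infinity>k\<in>{- x..}. J M Z \<beta> (x + k) \<theta> * pmf p k)"
    by (rule infsum_cong) (simp add: J_eq_limit_value assms)
  also have "infsum ?f {..- x - 1} = (\<Sum>\<^sub>\<infinity>k\<in>{..- x - 1}. pmf p k)"
    by (rule infsum_cong) (simp add: limit_value_ruined)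
  finally show ?thesis by (simp add: G_def)
qed

lemma stage_cost_eq_G:
  assumes "\<theta> < 0"
  shows "exp (\<theta> * real_of_int a) * G M Z (pmf p) \<beta> (x - a) (\<theta> * \<beta>) = stage_cost limit_value x \<theta> a"
  using assms beta_pos by (simp add: stage_cost_def G_eq_expectation mult_neg_pos)

lemma fstar_largest_minimiser:
  assumes "\<theta> < 0" and "0 \<le> x"
  defines "a \<equiv> fstar M Z (pmf p) \<beta> x \<theta>"
  shows "a \<in> {0..x}"
    and "b \<in> {0..x} \<Longrightarrow> stage_cost limit_value x \<theta> a \<le> stage_cost limit_value x \<theta> b"
    and "b \<in> {0..x} \<Longrightarrow> a < b \<Longrightarrow> stage_cost limit_value x \<theta> a < stage_cost limit_value x \<theta> b"
proof -
  let ?c = "stage_cost limit_value x \<theta>"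
  let ?S = "{a \<in> {0..x}. \<forall>b\<in>{0..x}. ?c a \<le> ?c b}"
  have a: "a = Max ?S"
    using assms(2) by (auto simp: a_def fstar_def stage_cost_eq_G[OF assms(1)] is_arg_min_def actions_def not_less
        intro!: arg_cong[where f = Max])
  have fin: "finite ?S" by (rule finite_subset[of _ "{0..x}"]) auto
  have "arg_min_on ?c {0..x} \<in> ?S"
    using arg_min_if_finite(1)[of "{0..x}" ?c] arg_min_least[of "{0..x}" _ ?c] assms(2) by auto
  then have "Max ?S \<in> ?S" using fin by (intro Max_in) auto
  then show "a \<in> {0..x}" and le: "b \<in> {0..x} \<Longrightarrow> ?c a \<le> ?c b" for b
    unfolding a by auto
  show "?c a < ?c b" if b: "b \<in> {0..x}" "a < b"
  proof (rule ccontr)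
    assume "\<not> ?c a < ?c b"
    then have "\<forall>b'\<in>{0..x}. ?c b \<le> ?c b'" using le by (meson not_less order_trans)
    then have "b \<le> a" unfolding a using b(1) by (intro Max_ge[OF fin]) auto
    then show False using b(2) by simp
  qed
qed

lemma fstar_in_actions: "\<theta> < 0 \<Longrightarrow> fstar M Z (pmf p) \<beta> x \<theta> \<in> actions x"
  using fstar_largest_minimiser(1)[of \<theta> x] by (auto simp: actions_def fstar_def)

text \<open>
  The stage cost of retaining \<open>y\<close> out of \<open>x\<close>, divided by \<open>exp (\<theta> * x)\<close>, which leaves no
  dependence on \<open>x\<close>.
\<close>

definition retention_cost :: "real \<Rightarrow> int \<Rightarrow> real" where
  "retention_cost \<theta> y =
     exp (- \<theta> * real_of_int y) * measure_pmf.expectation p (\<lambda>z. limit_value (y + z) (\<theta> * \<beta>))"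

definition record_levels :: "real \<Rightarrow> nat set" where
  "record_levels \<theta> = {y. \<forall>y'<y. retention_cost \<theta> (int y) < retention_cost \<theta> (int y')}"

lemma stage_cost_eq_retention_cost:
  "stage_cost limit_value x \<theta> a = exp (\<theta> * real_of_int x) * retention_cost \<theta> (x - a)"
  by (simp add: stage_cost_def retention_cost_def exp_add[symmetric] algebra_simps)

text \<open>
  At a record the retention cost is at most 1, while it grows at least like
  \<open>exp (- \<theta> * (1 - \<beta>) * y)\<close>; this bounds the record levels by \<open>slack / (1 - \<beta>)\<close>.
\<close>

lemma finite_record_levels:
  assumes "\<theta> < 0"
  shows "finite (record_levels \<theta>)"
proof (rule finite_subset)
  have nonpos: "\<theta> * \<beta> \<le> 0" using assms next_discount_nonpos by simp
  show "record_levels \<theta> \<subseteq> {..nat \<lfloor>slack / (1 - \<beta>)\<rfloor>}"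
  proof
    fix y assume "y \<in> record_levels \<theta>"
    then have "retention_cost \<theta> (int y) \<le> retention_cost \<theta> 0"
      by (cases "y = 0") (auto simp: record_levels_def less_imp_le)
    also have "\<dots> \<le> 1"
      unfolding retention_cost_def
      using limit_value_nonneg[OF nonpos] limit_value_bounds(2)[OF nonpos]
      by (simp add: expectation_unit_interval(2))
    finally have "retention_cost \<theta> (int y) \<le> 1" .
    moreover have "exp (- \<theta> * real y) * exp (\<theta> * \<beta> * ((real y + slack) + mean_pos)) \<le> retention_cost \<theta> (int y)"
      unfolding retention_cost_def
      using expectation_after_step_ge_exp[where y = "int y", OF nonpos _ limit_value_bounds[OF nonpos]] by simp
    ultimately have "exp (- \<theta> * real y + \<theta> * \<beta> * ((real y + slack) + mean_pos)) \<le> exp 0"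
      by (simp only: exp_add exp_zero)
    then have "- \<theta> * real y + \<theta> * \<beta> * ((real y + slack) + mean_pos) \<le> 0"
      by (simp only: exp_le_cancel_iff)
    moreover have "- \<theta> * real y + \<theta> * \<beta> * ((real y + slack) + mean_pos)
        = - \<theta> * (real y * (1 - \<beta>) - \<beta> * (mean_pos + slack))"
      by (simp add: algebra_simps)
    ultimately have "- \<theta> * (real y * (1 - \<beta>) - slack) \<le> 0" by (simp only: slack_eq[symmetric])
    then have "real y * (1 - \<beta>) \<le> slack" using assms by (simp add: zero_le_mult_iff)
    then have "real y \<le> slack / (1 - \<beta>)" using beta_less_1 by (simp add: field_simps)
    then show "y \<in> {..nat \<lfloor>slack / (1 - \<beta>)\<rfloor>}" by (simp add: le_nat_floor)
  qed
qed simp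

text \<open>
  The level retained is the smallest minimiser of the retention cost on \<open>{0..x}\<close>. It is a record, and
  a later record up to \<open>x\<close> would have a smaller cost than this minimum.
\<close>

lemma band_function_fstar:
  assumes "\<theta> < 0"
  shows "band_function (\<lambda>x. fstar M Z (pmf p) \<beta> x \<theta>)"
proof (rule band_function_if_last_point_of_finite_set[where A = "record_levels \<theta>"])
  show "finite (record_levels \<theta>)" using assms by (rule finite_record_levels)
  show "0 \<in> record_levels \<theta>" by (simp add: record_levels_def)
  show "fstar M Z (pmf p) \<beta> x \<theta> = 0" if "x < 0" for x using that by (simp add: fstar_def)
  fix x :: nat
  define a where "a = fstar M Z (pmf p) \<beta> (int x) \<theta>"
  have a: "0 \<le> a" "a \<le> int x"
    using fstar_largest_minimiser(1)[OF assms, of "int x"] by (simp_all add: a_def)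
  have kept: "int (nat (int x - a)) = int x - a" using a by simp
  have minimal: "retention_cost \<theta> (int x - a) \<le> retention_cost \<theta> (int y)" if "y \<le> x" for y
    using fstar_largest_minimiser(2)[OF assms, of "int x" "int x - int y"] that
    by (simp add: a_def[symmetric] stage_cost_eq_retention_cost)
  have "retention_cost \<theta> (int x - a) < retention_cost \<theta> (int y)" if "int y < int x - a" for y
    using fstar_largest_minimiser(3)[OF assms, of "int x" "int x - int y"] that a
    by (simp add: a_def[symmetric] stage_cost_eq_retention_cost)
  then have is_record: "nat (int x - a) \<in> record_levels \<theta>"
    unfolding record_levels_def using kept by auto
  have "Max {y \<in> record_levels \<theta>. y \<le> x} = nat (int x - a)"
  proof (rule Max_eqI)
    show "nat (int x - a) \<in> {y \<in> record_levels \<theta>. y \<le> x}" using is_record a by auto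
    show "y \<le> nat (int x - a)" if "y \<in> {y \<in> record_levels \<theta>. y \<le> x}" for y
    proof (rule ccontr)
      assume "\<not> y \<le> nat (int x - a)"
      then have "retention_cost \<theta> (int y) < retention_cost \<theta> (int x - a)"
        using that kept by (auto simp: record_levels_def not_le)
      then show False using minimal[of y] that by auto
    qed
  qed (use finite_record_levels[OF assms] in simp)
  then show "fstar M Z (pmf p) \<beta> (int x) \<theta> = int x - int (Max {y \<in> record_levels \<theta>. y \<le> x})"
    using kept by (simp add: a_def)
qed

end

section \<open>The common law of the increments\<close>

lemma (in prob_space) distr_eq_measure_pmf:
  fixes X :: "'a \<Rightarrow> 'b::countable"
  assumes X: "X \<in> measurable M (count_space UNIV)"
    and q: "\<And>k. measure M {\<omega> \<in> space M. X \<omega> = k} = pmf p k"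
  shows "distr M (count_space UNIV) X = measure_pmf p"
proof (rule measure_eqI_countable[where A = UNIV])
  fix k
  have "X -` {k} \<inter> space M = {\<omega> \<in> space M. X \<omega> = k}" by auto
  then show "emeasure (distr M (count_space UNIV) X) {k} = emeasure (measure_pmf p) {k}"
    using q[of k] by (simp add: emeasure_distr[OF X] emeasure_eq_measure emeasure_pmf_single)
qed auto

lemma (in prob_space) obtain_pmf_of_discrete:
  fixes X :: "'a \<Rightarrow> 'b::countable"
  assumes X: "X \<in> measurable M (count_space UNIV)"
  obtains p where "\<And>k. pmf p k = measure M {\<omega> \<in> space M. X \<omega> = k}"
proof -
  let ?D = "distr M (count_space UNIV) X"
  interpret D: prob_space ?D by (rule prob_space_distr[OF X])
  have "AE x in ?D. measure ?D {x} \<noteq> 0"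
    by (subst D.AE_support_countable) (auto intro: exI[of _ UNIV])
  then have "measure_pmf (Abs_pmf ?D) = ?D"
    by (intro Abs_pmf_inverse) (simp add: D.prob_space_axioms)
  then have "pmf (Abs_pmf ?D) k = measure ?D {k}" for k by (simp add: pmf.rep_eq)
  moreover have "measure ?D {k} = measure M {\<omega> \<in> space M. X \<omega> = k}" for k
    by (subst measure_distr[OF X]) (auto intro: arg_cong[where f = "measure M"])
  ultimately show ?thesis by (intro that) simp
qed

theorem theorem3p13:
  fixes M :: "'w measure" and Z :: "nat \<Rightarrow> 'w \<Rightarrow> int" and q :: "int \<Rightarrow> real"
    and \<beta> \<gamma> :: real
  assumes "0 < \<beta>" and "\<beta> < 1" and "\<gamma> < 0"
    and "prob_space M"
    and "prob_space.indep_vars M (\<lambda>_. count_space UNIV) Z {1..}"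
    and "\<And>n k. n \<ge> 1 \<Longrightarrow> measure M {\<omega> \<in> space M. Z n \<omega> = k} = q k"
    and "integrable M (\<lambda>\<omega>. real_of_int (max (Z 1 \<omega>) 0))"
    and "measure M {\<omega> \<in> space M. Z 1 \<omega> < 0} > 0"
  defines "\<pi> \<equiv> markov_policy (\<lambda>n x. fstar M Z q \<beta> x (\<gamma> * \<beta> ^ n))"
  shows "optimal_policy M Z \<beta> \<gamma> \<pi> \<and> band_policy \<pi>"
proof -
  interpret prob_space M by fact
  have measurable_Z: "Z n \<in> measurable M (count_space UNIV)" if "1 \<le> n" for n
    using assms(5) that by (auto simp: indep_vars_def)
  obtain p where p: "\<And>k. pmf p k = measure M {\<omega> \<in> space M. Z 1 \<omega> = k}"
    using obtain_pmf_of_discrete[OF measurable_Z[OF order_refl]] by metis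
  have q: "q = pmf p" using p assms(6)[of 1] by auto
  have distr: "distr M (count_space UNIV) (Z n) = measure_pmf p" if "1 \<le> n" for n
    using assms(6)[OF that] by (intro distr_eq_measure_pmf measurable_Z that) (simp add: q)
  have "integrable (distr M (count_space UNIV) (Z 1)) (\<lambda>z. real_of_int (max z 0))"
    using assms(7) by (subst integrable_distr_eq[OF measurable_Z]) simp_all
  then have "integrable (measure_pmf p) (\<lambda>z. real_of_int (max z 0))"
    by (simp only: distr[OF order_refl])
  then interpret dividend_problem p \<beta> M Z
    using assms(1,2,5) distr by unfold_locales
  have neg: "\<gamma> * \<beta> ^ n < 0" for n using assms(1,3) by (simp add: mult_neg_pos)
  have policy: "\<pi> \<in> policies"
    unfolding \<pi>_def q by (intro markov_policy_in_policies fstar_in_actions neg)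
  have "conserving \<pi> \<gamma>"
    unfolding conserving_def \<pi>_def markov_policy_def q
    using fstar_largest_minimiser(2)[OF neg] by blast
  then have "disutility \<pi> x \<gamma> \<le> disutility \<pi>' x \<gamma>" if "\<pi>' \<in> policies" for \<pi>' x
    using that policy assms(3) by (simp add: disutility_of_conserving limit_value_le_disutility)
  moreover have "expected_utility M Z \<beta> \<gamma> x \<pi>' = disutility \<pi>' x \<gamma> / \<gamma>" for \<pi>' x
    by (simp add: expected_utility_def disutility_def)
  ultimately have "optimal_policy M Z \<beta> \<gamma> \<pi>"
    using policy assms(3)
    by (auto simp: optimal_policy_def is_arg_max_def not_less intro!: divide_right_mono_neg)
  moreover have "band_policy \<pi>"
    unfolding band_policy_def \<pi>_def q using band_function_fstar[OF neg] by blast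
  ultimately show ?thesis by blast
qed

end
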